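(* Consider a distributed random convex program over a strongly connected directed graph $\mathcal{G}$ with local constraint sets $C_1,\dots,C_n$, such that for every $x\in X$ the function $\delta\mapsto f(x,\delta)$ is convex on $\Delta$, and let all nodes run the quantized vertex constraints consensus (qVCC) algorithm with message size $m$, as described in the context. Let $N_{\max}=\max_{i}|C_i|$ and $d_{\max}=\max_i|\mathcal{N}_{\rm in}(i)|$. Then: (i) for each node $i$, the local optimal objective $J_i^*(t)=J^*(V_i(t))$ is monotonically non-decreasing in the iterations $t$; (ii) in $$T\le\left\lceil\frac{N_{\max}}{m}\right\rceil\frac{(d_{\max}+1)^{\mathrm{diam}(\mathcal{G})}-1}{d_{\max}}$$ iterations the local solution at each node $i$ converges to the scenario solution of the RCP, i.e. $x^*(V_i(T))=x^*(C)$; (iii) for each node $i$, the local candidate set $V_i(T)$ satisfies $V_i(T)=\mathrm{vert}(C)\supseteq\mathrm{Sc}(C)$.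
   Context: Problem. Let $X\subset\mathbb{R}^d$ be compact and convex, $a\in\mathbb{R}^d$, $\Delta\subseteq\mathbb{R}^\ell$ convex, and $f:\mathbb{R}^d\times\Delta\to\mathbb{R}$ with $f(\cdot,\delta)$ convex for every $\delta\in\Delta$. Let $\delta^{(1)},\dots,\delta^{(N)}\in\Delta$ be a given realization of $N$ i.i.d. samples of a random parameter, and $C=\{1,\dots,N\}$. For $S\subseteq C$, $P[S]$ is the problem: minimize $a^\top x$ over $x\in X$ subject to $f(x,\delta^{(j)})\le 0$ for all $j\in S$; its optimal solution and value are $x^*(S)$ and $J^*(S)$, with $x^*(S)=\mathrm{NaN}$ and $J^*(S)=\infty$ if $P[S]$ is infeasible. $P[C]$ is an instance of a random convex program (RCP), and $x^*(C)$ is the scenario solution. Standing assumption (unique minimum condition): every feasible $P[S]$, $S\subseteq C$, has a unique optimal solution. Support constraint set: $\mathrm{Sc}(C)=\{c\in C: J^*(C\setminus\{c\})<J^*(C)\}$. Vertex set: for $S\subseteq C$, $\mathrm{vert}(S)\subseteq S$ is the set of indices $j\in S$ such that $\delta^{(j)}$ is a vertex (extreme point) of the convex hull of $\{\delta^{(k)}:k\in S\}$. Network. $\mathcal{G}$ is a strongly connected directed graph on nodes $\{1,\dots,n\}$; an edge $(i,j)$ means $i$ can transmit to $j$; $\mathcal{N}_{\rm in}(i)$ is the set of in-neighbors of $i$; $\mathrm{diam}(\mathcal{G})$ is the maximum over ordered pairs of nodes of the length of a shortest directed path. Node $i$ initially knows a subset $C_i\subset C$, with $\bigcup_{i=1}^nC_i=C$.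 qVCC algorithm (synchronous, run by each node $i$; $m\ge1$ is a fixed integer, the maximum number of constraints a node can transmit in one communication round). Node $i$ stores a candidate set $V_i(t)$ and an ordered transmission set $T_i(t)$, initialized as $V_i(0)=T_i(0)=\mathrm{vert}(C_i)$ (in any order). At each iteration $t=0,1,2,\dots$: node $i$ forms the message $M_i(t)$ consisting of the first $m$ elements of $T_i(t)$ (all of them if there are fewer than $m$), sends it to its out-neighbors, and receives $M_j(t)$ from all $j\in\mathcal{N}_{\rm in}(i)$; it sets $L_i(t+1)=V_i(t)\cup\big(\bigcup_{j\in\mathcal{N}_{\rm in}(i)}M_j(t)\big)$, $V_i(t+1)=\mathrm{vert}(L_i(t+1))$, and $T_i(t+1)=T_i(t)\setminus\{M_i(t)\cup(V_i(t)\setminus V_i(t+1))\}\oplus\{V_i(t+1)\setminus V_i(t)\}$, where $\oplus$ denotes concatenation of ordered sets (first remove from $T_i(t)$ the transmitted constraints and those dropped from the candidate set, then append at the end those newly added to the candidate set). The iterations continue until all transmission sets are empty, after which the sets no longer change. The local solution and local optimal objective at iteration $t$ are $x^*(V_i(t))$ and $J^*(V_i(t))$. *)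

theory Defs
  imports "HOL-Analysis.Analysis" "Graph_Theory.Graph_Theory"
begin

definition feasible_set ::
  "(real^'d) set \<Rightarrow> (real^'d \<Rightarrow> real^'l \<Rightarrow> real) \<Rightarrow> (nat \<Rightarrow> real^'l) \<Rightarrow> nat set \<Rightarrow> (real^'d) set"
  where "feasible_set X f \<delta> S = {x \<in> X. \<forall>j\<in>S. f x (\<delta> j) \<le> 0}"

definition is_solution ::
  "real^'d \<Rightarrow> (real^'d) set \<Rightarrow> (real^'d \<Rightarrow> real^'l \<Rightarrow> real) \<Rightarrow> (nat \<Rightarrow> real^'l) \<Rightarrow> nat set
    \<Rightarrow> real^'d \<Rightarrow> bool"
  where "is_solution a X f \<delta> S x \<longleftrightarrow> is_arg_min (\<lambda>y. a \<bullet> y) (\<lambda>y. y \<in> feasible_set X f \<delta> S) x"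

(* None plays the role of NaN. *)
definition xstar ::
  "real^'d \<Rightarrow> (real^'d) set \<Rightarrow> (real^'d \<Rightarrow> real^'l \<Rightarrow> real) \<Rightarrow> (nat \<Rightarrow> real^'l) \<Rightarrow> nat set
    \<Rightarrow> (real^'d) option"
  where "xstar a X f \<delta> S =
    (if feasible_set X f \<delta> S = {} then None else Some (SOME x. is_solution a X f \<delta> S x))"

(* The infimum over the empty set is \<infinity>, as required for infeasible problems. *)
definition Jstar ::
  "real^'d \<Rightarrow> (real^'d) set \<Rightarrow> (real^'d \<Rightarrow> real^'l \<Rightarrow> real) \<Rightarrow> (nat \<Rightarrow> real^'l) \<Rightarrow> nat set \<Rightarrow> ereal"
  where "Jstar a X f \<delta> S = (INF x\<in>feasible_set X f \<delta> S. ereal (a \<bullet> x))"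

definition Sc ::
  "real^'d \<Rightarrow> (real^'d) set \<Rightarrow> (real^'d \<Rightarrow> real^'l \<Rightarrow> real) \<Rightarrow> (nat \<Rightarrow> real^'l) \<Rightarrow> nat set \<Rightarrow> nat set"
  where "Sc a X f \<delta> C = {c \<in> C. Jstar a X f \<delta> (C - {c}) < Jstar a X f \<delta> C}"

(* An index set: if several samples coincide at an extreme point, all their indices belong to it. *)
definition vert :: "(nat \<Rightarrow> real^'l) \<Rightarrow> nat set \<Rightarrow> nat set"
  where "vert \<delta> S = {j \<in> S. (\<delta> j) extreme_point_of (convex hull (\<delta> ` S))}"

definition in_nbrs :: "('v, 'e) pre_digraph \<Rightarrow> 'v \<Rightarrow> 'v set"
  where "in_nbrs G i = {j. j \<rightarrow>\<^bsub>G\<^esub> i}"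

definition dist_digraph :: "('v, 'e) pre_digraph \<Rightarrow> 'v \<Rightarrow> 'v \<Rightarrow> nat"
  where "dist_digraph G u v = (LEAST k. \<exists>p. pre_digraph.apath G u p v \<and> length p = k)"

definition diam :: "('v, 'e) pre_digraph \<Rightarrow> nat"
  where "diam G = Max {dist_digraph G u v | u v. u \<in> verts G \<and> v \<in> verts G}"

definition max_in_nbrs :: "('v, 'e) pre_digraph \<Rightarrow> nat"
  where "max_in_nbrs G = Max ((\<lambda>i. card (in_nbrs G i)) ` verts G)"

(* Ordered sets are lists without repetition. The order in which vert (Cl i) is listed initially,
   and in which newly added indices are appended, is arbitrary; hence a relation on executions
   V t i, T t i rather than a function. No explicit stopping rule is needed: once all
   transmission sets are empty, the recursion leaves V and T unchanged. *)
definition qvcc_run ::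
  "('v, 'e) pre_digraph \<Rightarrow> (nat \<Rightarrow> real^'l) \<Rightarrow> nat \<Rightarrow> ('v \<Rightarrow> nat set)
    \<Rightarrow> (nat \<Rightarrow> 'v \<Rightarrow> nat set) \<Rightarrow> (nat \<Rightarrow> 'v \<Rightarrow> nat list) \<Rightarrow> bool"
  where "qvcc_run G \<delta> m Cl V T \<longleftrightarrow>
    (\<forall>i\<in>verts G. V 0 i = vert \<delta> (Cl i) \<and> distinct (T 0 i) \<and> set (T 0 i) = vert \<delta> (Cl i)) \<and>
    (\<forall>t. \<forall>i\<in>verts G.
       V (Suc t) i = vert \<delta> (V t i \<union> (\<Union>j\<in>in_nbrs G i. set (take m (T t j)))) \<and>
       (\<exists>ys. distinct ys \<and> set ys = V (Suc t) i - V t i \<and>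
          T (Suc t) i =
            filter (\<lambda>c. c \<notin> set (take m (T t i)) \<union> (V t i - V (Suc t) i)) (T t i) @ ys))"

end

theory Submission
  imports Defs
begin

text \<open>
  Geometry. By Minkowski's theorem, replacing a finite index set \<open>S\<close> by \<open>vert \<delta> S\<close> leaves the convex
  hull of the samples unchanged (\<open>hull_vert\<close>). As \<open>f x\<close> is convex in the parameter, its
  nonpositivity at some samples extends to their hull, so the feasible set depends on the hull only
  and shrinks as the hull grows (\<open>feasible_set_antimono\<close>). The hull of a node's candidate set never
  shrinks, hence its optimal value never decreases, and a node whose candidate set is \<open>vert \<delta> C\<close>
  has the feasible set, and so the solution, of the whole program. Likewise, dropping a
  non-vertex leaves the value unchanged, so every support constraint is a vertex.

  Speed. A vertex of the whole sample set is a vertex of every subset that contains it, so a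
  node that has received it never discards it (\<open>keep_vertex\<close>), and it leaves the node's
  transmission queue only by being sent. The queue is first-in first-out: an index among the first
  \<open>m * k\<close> entries is gone after \<open>k\<close> rounds (\<open>sent_within\<close>). With in-degree at most \<open>d\<close>
  and at most \<open>m * q\<close> initial constraints at each node, a queue at time \<open>t\<close> has length at most
  \<open>m * q + d * m * t\<close> (\<open>length_queue\<close>). At the time \<open>t\<^sub>k = q * (\<Sum>j<k. (d + 1) ^ j)\<close> this bound is exactly
  \<open>m * q * (d + 1) ^ k\<close>, so every global vertex queued at \<open>t\<^sub>k\<close> is sent before
  \<open>t\<^sub>k + q * (d + 1) ^ k\<close>, the next of these times. Therefore each global vertex advances at least one
  edge between consecutive times \<open>t\<^sub>k\<close> (\<open>vertex_along_walk\<close>) and has reached all nodes at the time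
  indexed by the diameter. With \<open>q = \<lceil>Nmax / m\<rceil>\<close> the geometric sum is the stated bound.
\<close>

section \<open>Vertex sets and convex hulls\<close>

lemma vert_subset: "vert \<delta> S \<subseteq> S"
  by (auto simp: vert_def)

lemma hull_vert:
  assumes "finite S"
  shows "convex hull (\<delta> ` vert \<delta> S) = convex hull (\<delta> ` S)"
proof -
  have "{x. x extreme_point_of convex hull (\<delta> ` S)} = \<delta> ` vert \<delta> S"
    by (auto simp: vert_def dest: extreme_point_of_convex_hull)
  moreover have "compact (convex hull (\<delta> ` S))"
    using assms by (simp add: finite_imp_compact_convex_hull)
  ultimately show ?thesis
    using Krein_Milman_Minkowski[of "convex hull (\<delta> ` S)"] by simp
qed

lemma vert_restrict:
  assumes "c \<in> vert \<delta> C" "c \<in> S" "S \<subseteq> C"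
  shows "c \<in> vert \<delta> S"
proof -
  have "convex hull (\<delta> ` S) \<subseteq> convex hull (\<delta> ` C)"
    using assms by (intro hull_mono) auto
  moreover have "\<delta> c \<in> convex hull (\<delta> ` S)"
    using assms by (auto intro: hull_inc)
  ultimately show ?thesis
    using assms by (auto simp: vert_def extreme_point_of_def)
qed

text \<open>A set sandwiched between the vertices of \<open>C\<close> and \<open>C\<close> has the same hull as \<open>C\<close>, hence the
  same extreme points.\<close>

lemma vert_eq_vert:
  assumes "finite C" "vert \<delta> C \<subseteq> S" "S \<subseteq> C"
  shows "vert \<delta> S = vert \<delta> C"
proof -
  have "convex hull (\<delta> ` vert \<delta> C) \<subseteq> convex hull (\<delta> ` S)"
    "convex hull (\<delta> ` S) \<subseteq> convex hull (\<delta> ` C)"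
    using assms by (auto intro!: hull_mono)
  then have "convex hull (\<delta> ` S) = convex hull (\<delta> ` C)"
    using hull_vert[OF assms(1)] by auto
  then show ?thesis
    using assms by (auto simp: vert_def)
qed

section \<open>Feasible sets and optimal values\<close>

lemma feasible_set_antimono:
  assumes "\<And>x. x \<in> X \<Longrightarrow> convex_on \<Delta> (f x)"
    and "\<delta> ` S \<subseteq> \<Delta>" and "\<delta> ` S' \<subseteq> convex hull (\<delta> ` S)"
  shows "feasible_set X f \<delta> S \<subseteq> feasible_set X f \<delta> S'"
proof
  fix x assume x: "x \<in> feasible_set X f \<delta> S"
  then have "x \<in> X" by (simp add: feasible_set_def)
  then have "convex_on \<Delta> (f x)"
    by (rule assms(1))
  then have "convex {d \<in> \<Delta>. f x d \<le> 0}"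
  proof (intro convexI CollectI conjI; clarify)
    fix d e and u v :: real
    assume c: "d \<in> \<Delta>" "e \<in> \<Delta>" "0 \<le> u" "0 \<le> v" "u + v = 1" and "f x d \<le> 0" "f x e \<le> 0"
    then show "f x (u *\<^sub>R d + v *\<^sub>R e) \<le> 0"
      using convex_lower[OF \<open>convex_on \<Delta> (f x)\<close> c] by simp
    show "u *\<^sub>R d + v *\<^sub>R e \<in> \<Delta>"
      using convex_on_imp_convex[OF \<open>convex_on \<Delta> (f x)\<close>] c by (rule convexD)
  qed
  moreover have "\<delta> ` S \<subseteq> {d \<in> \<Delta>. f x d \<le> 0}"
    using x assms(2) by (auto simp: feasible_set_def)
  ultimately have "convex hull (\<delta> ` S) \<subseteq> {d \<in> \<Delta>. f x d \<le> 0}"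
    by (intro hull_minimal)
  then show "x \<in> feasible_set X f \<delta> S'"
    using assms(3) \<open>x \<in> X\<close> by (auto simp: feasible_set_def)
qed

lemma feasible_set_vert:
  assumes "\<And>x. x \<in> X \<Longrightarrow> convex_on \<Delta> (f x)" "\<delta> ` S \<subseteq> \<Delta>" "finite S"
  shows "feasible_set X f \<delta> (vert \<delta> S) = feasible_set X f \<delta> S"
proof
  show "feasible_set X f \<delta> (vert \<delta> S) \<subseteq> feasible_set X f \<delta> S"
    using assms vert_subset[of \<delta> S]
    by (intro feasible_set_antimono[where \<Delta> = \<Delta>]) (auto simp: hull_vert intro: hull_inc)
  show "feasible_set X f \<delta> S \<subseteq> feasible_set X f \<delta> (vert \<delta> S)"
    using vert_subset[of \<delta> S] by (auto simp: feasible_set_def)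
qed

lemma Jstar_mono:
  assumes "feasible_set X f \<delta> S' \<subseteq> feasible_set X f \<delta> S"
  shows "Jstar a X f \<delta> S \<le> Jstar a X f \<delta> S'"
  unfolding Jstar_def using assms by (intro INF_superset_mono) auto

lemma Sc_subset_vert:
  assumes "\<And>x. x \<in> X \<Longrightarrow> convex_on \<Delta> (f x)" "\<delta> ` C \<subseteq> \<Delta>" "finite C"
  shows "Sc a X f \<delta> C \<subseteq> vert \<delta> C"
proof
  fix c assume c: "c \<in> Sc a X f \<delta> C"
  show "c \<in> vert \<delta> C"
  proof (rule ccontr)
    assume "c \<notin> vert \<delta> C"
    then have "vert \<delta> C \<subseteq> C - {c}"
      using vert_subset[of \<delta> C] by auto
    then have "feasible_set X f \<delta> (C - {c}) \<subseteq> feasible_set X f \<delta> (vert \<delta> C)"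
      by (auto simp: feasible_set_def)
    then have "Jstar a X f \<delta> C \<le> Jstar a X f \<delta> (C - {c})"
      using feasible_set_vert[where X = X and f = f, OF assms] by (intro Jstar_mono) simp
    with c show False
      by (auto simp: Sc_def dest: leD)
  qed
qed

section \<open>Executions of the quantized consensus algorithm\<close>

text \<open>\<open>phase_end q d k\<close> is the time by which a vertex known initially at a node is known at distance
  \<open>k\<close>, when \<open>q\<close> rounds suffice to empty an initial queue and nodes have in-degree at most \<open>d\<close>.\<close>

definition phase_end :: "nat \<Rightarrow> nat \<Rightarrow> nat \<Rightarrow> nat" where
  "phase_end q d k = q * (\<Sum>j<k. (d + 1) ^ j)"

lemma phase_end_0 [simp]: "phase_end q d 0 = 0"
  by (simp add: phase_end_def)

lemma phase_end_Suc: "phase_end q d (Suc k) = phase_end q d k + q * (d + 1) ^ k"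
  by (simp add: phase_end_def algebra_simps)

lemma phase_end_mono: "k \<le> l \<Longrightarrow> phase_end q d k \<le> phase_end q d l"
  unfolding phase_end_def by (intro mult_left_mono sum_mono2) auto

text \<open>This identity determines the lengths of the phases: the initial load plus what
  arrives up to the end of phase \<open>k\<close> is precisely what can be sent during phase \<open>k + 1\<close>.\<close>

lemma phase_load: "q + d * phase_end q d k = q * (d + 1) ^ k"
  by (induction k) (auto simp: phase_end_Suc algebra_simps)

lemma real_phase_end:
  assumes "d > 0"
  shows "real (phase_end q d k) = real q * (((real d + 1) ^ k - 1) / real d)"
proof -
  have "real q + real d * real (phase_end q d k) = real q * (real d + 1) ^ k"
    using arg_cong[OF phase_load[of q d k], of real] by (simp add: add.commute)
  then show ?thesis
    using assms by (simp add: field_simps)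
qed

locale qvcc_execution = fin_digraph G for G :: "('v, 'e) pre_digraph" +
  fixes \<delta> :: "nat \<Rightarrow> real^'l" and m :: nat and Cl :: "'v \<Rightarrow> nat set" and C :: "nat set"
    and V :: "nat \<Rightarrow> 'v \<Rightarrow> nat set" and T :: "nat \<Rightarrow> 'v \<Rightarrow> nat list"
  assumes run: "qvcc_run G \<delta> m Cl V T"
    and finite_C: "finite C"
    and cover: "(\<Union>i\<in>verts G. Cl i) = C"
begin

abbreviation msg :: "nat \<Rightarrow> 'v \<Rightarrow> nat set" where
  "msg t i \<equiv> set (take m (T t i))"

lemma Cl_subset: "i \<in> verts G \<Longrightarrow> Cl i \<subseteq> C"
  using cover by auto

lemma V_0: "i \<in> verts G \<Longrightarrow> V 0 i = vert \<delta> (Cl i)"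
  using run unfolding qvcc_run_def by blast

lemma distinct_T_0: "i \<in> verts G \<Longrightarrow> distinct (T 0 i)"
  using run unfolding qvcc_run_def by blast

lemma set_T_0: "i \<in> verts G \<Longrightarrow> set (T 0 i) = V 0 i"
  using run V_0 unfolding qvcc_run_def by blast

lemma V_Suc: "i \<in> verts G \<Longrightarrow> V (Suc t) i = vert \<delta> (V t i \<union> (\<Union>j\<in>in_nbrs G i. msg t j))"
  using run unfolding qvcc_run_def by blast

lemma T_Suc:
  assumes "i \<in> verts G"
  obtains ys where "distinct ys" "set ys = V (Suc t) i - V t i"
    "T (Suc t) i = filter (\<lambda>c. c \<notin> msg t i \<union> (V t i - V (Suc t) i)) (T t i) @ ys"
  using run assms unfolding qvcc_run_def by blast

lemma in_nbrs_in_verts: "j \<in> in_nbrs G i \<Longrightarrow> j \<in> verts G"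
  by (auto simp: in_nbrs_def dest: adj_in_verts)

lemma finite_in_nbrs: "finite (in_nbrs G i)"
  by (rule finite_subset[of _ "verts G"]) (auto dest: in_nbrs_in_verts)

lemma queue_subset: "i \<in> verts G \<Longrightarrow> set (T t i) \<subseteq> V t i"
proof (induction t)
  case 0
  then show ?case by (simp add: set_T_0)
next
  case (Suc t)
  obtain ys where ys: "distinct ys" "set ys = V (Suc t) i - V t i"
    "T (Suc t) i = filter (\<lambda>c. c \<notin> msg t i \<union> (V t i - V (Suc t) i)) (T t i) @ ys"
    by (rule T_Suc[OF Suc.prems, where t = t])
  show ?case
  proof
    fix c assume "c \<in> set (T (Suc t) i)"
    then show "c \<in> V (Suc t) i"
      using ys(2,3) Suc.IH[OF Suc.prems] by auto
  qed
qed

lemma msg_subset: "i \<in> verts G \<Longrightarrow> msg t i \<subseteq> V t i"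
  using queue_subset set_take_subset by fastforce

lemma V_subset: "i \<in> verts G \<Longrightarrow> V t i \<subseteq> C"
proof (induction t arbitrary: i)
  case 0
  then show ?case using V_0 vert_subset Cl_subset by blast
next
  case (Suc t)
  have "msg t j \<subseteq> C" if "j \<in> in_nbrs G i" for j
    using Suc.IH msg_subset in_nbrs_in_verts[OF that] by blast
  then have "V t i \<union> (\<Union>j\<in>in_nbrs G i. msg t j) \<subseteq> C"
    using Suc by blast
  then show ?case
    using V_Suc[OF Suc.prems] vert_subset by blast
qed

lemma L_subset: "i \<in> verts G \<Longrightarrow> V t i \<union> (\<Union>j\<in>in_nbrs G i. msg t j) \<subseteq> C"
  using V_subset msg_subset in_nbrs_in_verts by blast

lemma V_hull_mono:
  assumes "i \<in> verts G"
  shows "\<delta> ` V t i \<subseteq> convex hull (\<delta> ` V (Suc t) i)"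
proof -
  have "finite (V t i \<union> (\<Union>j\<in>in_nbrs G i. msg t j))"
    using L_subset[OF assms] finite_C finite_subset by blast
  then show ?thesis
    by (auto simp: V_Suc[OF assms] hull_vert intro: hull_inc)
qed

lemma keep_vertex:
  assumes "i \<in> verts G" "c \<in> vert \<delta> C" "c \<in> V t i" "t \<le> s"
  shows "c \<in> V s i"
  using assms(4)
proof (induction s rule: dec_induct)
  case base
  show ?case by (rule assms)
next
  case (step s)
  show ?case
    unfolding V_Suc[OF assms(1)]
    by (rule vert_restrict[OF assms(2) _ L_subset[OF assms(1)]]) (use step.IH in blast)
qed

lemma receive_vertex:
  assumes "i \<in> verts G" "c \<in> vert \<delta> C" "j \<in> in_nbrs G i" "c \<in> msg t j"
  shows "c \<in> V (Suc t) i"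
  unfolding V_Suc[OF assms(1)]
  by (rule vert_restrict[OF assms(2) _ L_subset[OF assms(1)]]) (use assms(3,4) in blast)

text \<open>A global vertex held by a node is never dropped from its candidate set, so transmission is the
  only way in which it can have left the queue.\<close>

lemma queued_or_sent:
  assumes "i \<in> verts G" "c \<in> vert \<delta> C" "c \<in> V t i"
  shows "c \<in> set (T t i) \<or> (\<exists>s<t. c \<in> msg s i)"
  using assms(3)
proof (induction t)
  case 0
  then show ?case by (simp add: set_T_0 assms(1))
next
  case (Suc t)
  obtain ys where ys: "distinct ys" "set ys = V (Suc t) i - V t i"
    "T (Suc t) i = filter (\<lambda>c. c \<notin> msg t i \<union> (V t i - V (Suc t) i)) (T t i) @ ys"
    by (rule T_Suc[OF assms(1), where t = t])
  show ?case
  proof (cases "c \<in> V t i")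
    case True
    then consider "c \<in> msg t i" | "c \<in> set (T t i)" "c \<notin> msg t i" | "\<exists>s<t. c \<in> msg s i"
      using Suc.IH by blast
    then show ?thesis
    proof cases
      case 2
      then have "c \<in> set (T (Suc t) i)"
        using Suc.prems by (simp add: ys(3))
      then show ?thesis ..
    qed (auto intro: less_SucI)
  next
    case False
    then have "c \<in> set ys"
      using Suc.prems ys(2) by simp
    then show ?thesis
      by (simp add: ys(3))
  qed
qed

text \<open>Each round removes the first \<open>m\<close> entries of the queue and appends only behind the others, so
  a retained index moves forward by at least \<open>m\<close> places.\<close>

lemma sent_within:
  assumes "i \<in> verts G" "c \<in> vert \<delta> C"
    and "T t i = xs @ c # zs" "length xs < m * k"
  shows "\<exists>s. t \<le> s \<and> s < t + k \<and> c \<in> msg s i"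
  using assms(3,4)
proof (induction k arbitrary: t xs zs)
  case 0
  then show ?case by simp
next
  case (Suc k)
  show ?case
  proof (cases "c \<in> msg t i")
    case True
    then show ?thesis by (intro exI[of _ t]) auto
  next
    case False
    then have len: "m \<le> length xs"
      using Suc.prems(1) by (intro leI notI) (auto simp: take_Cons')
    then have msg: "msg t i = set (take m xs)"
      using Suc.prems(1) by simp
    obtain ys where ys: "distinct ys" "set ys = V (Suc t) i - V t i"
      "T (Suc t) i = filter (\<lambda>c. c \<notin> msg t i \<union> (V t i - V (Suc t) i)) (T t i) @ ys"
      by (rule T_Suc[OF assms(1), where t = t])
    define P where "P = (\<lambda>c. c \<notin> msg t i \<union> (V t i - V (Suc t) i))"
    have "c \<in> V t i"
      using queue_subset[OF assms(1), of t] Suc.prems(1) by auto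
    then have "c \<in> V (Suc t) i"
      using keep_vertex[OF assms(1,2), where t = t] by simp
    then have "P c"
      using False by (simp add: P_def)
    then have T': "T (Suc t) i = filter P xs @ c # (filter P zs @ ys)"
      using ys(3) Suc.prems(1) by (simp add: P_def)
    have "filter P xs = filter P (take m xs) @ filter P (drop m xs)"
      by (metis append_take_drop_id filter_append)
    moreover have "filter P (take m xs) = []"
      by (auto simp: filter_empty_conv P_def msg)
    ultimately have "length (filter P xs) \<le> length xs - m"
      using length_filter_le[of P "drop m xs"] by simp
    then have "length (filter P xs) < m * k"
      using Suc.prems(2) len by simp
    from Suc.IH[OF T' this] obtain s where "Suc t \<le> s" "s < Suc t + k" "c \<in> msg s i"
      by blast
    then show ?thesis
      by (intro exI[of _ s]) auto
  qed
qed

lemma length_queue: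
  assumes "i \<in> verts G" "card (in_nbrs G i) \<le> d"
  shows "length (T t i) \<le> card (Cl i) + d * m * t"
proof (induction t)
  case 0
  have "length (T 0 i) = card (vert \<delta> (Cl i))"
    using distinct_card[OF distinct_T_0] assms(1) by (simp add: set_T_0 V_0)
  also have "\<dots> \<le> card (Cl i)"
    using finite_subset[OF Cl_subset[OF assms(1)] finite_C] by (intro card_mono vert_subset)
  finally show ?case by simp
next
  case (Suc t)
  obtain ys where ys: "distinct ys" "set ys = V (Suc t) i - V t i"
    "T (Suc t) i = filter (\<lambda>c. c \<notin> msg t i \<union> (V t i - V (Suc t) i)) (T t i) @ ys"
    by (rule T_Suc[OF assms(1), where t = t])
  have "set ys \<subseteq> (\<Union>j\<in>in_nbrs G i. msg t j)"
    using ys(2) V_Suc[OF assms(1)] vert_subset by blast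
  then have "card (set ys) \<le> card (\<Union>j\<in>in_nbrs G i. msg t j)"
    by (intro card_mono) (auto simp: finite_in_nbrs)
  also have "\<dots> \<le> (\<Sum>j\<in>in_nbrs G i. card (msg t j))"
    by (rule card_UN_le[OF finite_in_nbrs])
  also have "\<dots> \<le> (\<Sum>j\<in>in_nbrs G i. m)"
    by (intro sum_mono order_trans[OF card_length]) auto
  also have "\<dots> \<le> d * m"
    using assms(2) by simp
  finally have "length ys \<le> d * m"
    using distinct_card[OF ys(1)] by simp
  moreover have "length (T (Suc t) i) \<le> length (T t i) + length ys"
    unfolding ys(3) by simp
  ultimately have "length (T (Suc t) i) \<le> card (Cl i) + d * m * t + d * m"
    using Suc.IH by linarith
  then show ?case
    by (simp add: algebra_simps)
qed

lemma vertex_one_edge: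
  assumes "u \<in> in_nbrs G v" "v \<in> verts G" "c \<in> vert \<delta> C"
    and deg: "card (in_nbrs G u) \<le> d" and load: "card (Cl u) \<le> m * q"
    and c: "c \<in> V (phase_end q d k) u"
  shows "c \<in> V (phase_end q d (Suc k)) v"
proof -
  let ?t = "phase_end q d k"
  have u: "u \<in> verts G"
    using assms(1) by (rule in_nbrs_in_verts)
  have "\<exists>s<phase_end q d (Suc k). c \<in> msg s u"
  proof (cases "\<exists>s<?t. c \<in> msg s u")
    case True
    then show ?thesis
      by (auto simp: phase_end_Suc intro: trans_less_add1)
  next
    case False
    then have "c \<in> set (T ?t u)"
      using queued_or_sent[OF u assms(3) c] by blast
    then obtain xs zs where split: "T ?t u = xs @ c # zs"
      by (auto dest: split_list)
    have "length (T ?t u) \<le> m * q + d * m * ?t"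
      using length_queue[OF u deg, of ?t] load by simp
    also have "\<dots> = m * (q + d * ?t)"
      by (simp add: algebra_simps)
    also have "\<dots> = m * (q * (d + 1) ^ k)"
      by (simp only: phase_load)
    finally have "length xs < m * (q * (d + 1) ^ k)"
      using split by simp
    from sent_within[OF u assms(3) split this] show ?thesis
      by (auto simp: phase_end_Suc)
  qed
  then obtain s where s: "s < phase_end q d (Suc k)" "c \<in> msg s u"
    by blast
  show ?thesis
    using keep_vertex[OF assms(2,3) receive_vertex[OF assms(2,3,1) s(2)]] s(1) by (simp add: Suc_leI)
qed

lemma vertex_along_walk:
  assumes "awalk u p v" "c \<in> vert \<delta> C"
    and "\<And>i. i \<in> verts G \<Longrightarrow> card (in_nbrs G i) \<le> d"
    and "\<And>i. i \<in> verts G \<Longrightarrow> card (Cl i) \<le> m * q"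
    and "c \<in> V (phase_end q d k) u"
  shows "c \<in> V (phase_end q d (k + length p)) v"
  using assms(1,5)
proof (induction p arbitrary: u k)
  case Nil
  then show ?case by (simp add: awalk_Nil_iff)
next
  case (Cons e es)
  then have e: "e \<in> arcs G" "u = tail G e" and walk: "awalk (head G e) es v"
    by (auto simp: awalk_Cons_iff)
  then have "u \<in> in_nbrs G (head G e)"
    by (auto simp: in_nbrs_def in_arcs_imp_in_arcs_ends)
  then have "c \<in> V (phase_end q d (Suc k)) (head G e)"
    using vertex_one_edge[OF _ _ assms(2)] assms(3,4) Cons.prems(2) e(1) in_nbrs_in_verts
    by simp
  from Cons.IH[OF walk this] show ?case by simp
qed

text \<open>The sandwich \<open>vert \<delta> C \<subseteq> V t i \<subseteq> C\<close> would already fix the hull; equality holds because a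
  candidate set is itself the vertex set of some subset of \<open>C\<close>.\<close>

lemma V_eq_vertI:
  assumes "i \<in> verts G" "vert \<delta> C \<subseteq> V t i"
  shows "V t i = vert \<delta> C"
proof -
  obtain L where "L \<subseteq> C" "V t i = vert \<delta> L"
  proof (cases t)
    case 0
    then show ?thesis
      using that[OF Cl_subset[OF assms(1)]] V_0[OF assms(1)] by simp
  next
    case (Suc s)
    then show ?thesis
      using that[OF L_subset[OF assms(1), of s]] V_Suc[OF assms(1), of s] by simp
  qed
  then show ?thesis
    using vert_eq_vert[OF finite_C, of \<delta> L] vert_subset[of \<delta> L] assms(2) by simp
qed

end

section \<open>Distances\<close>

context fin_digraph
begin

lemma dist_le_diam:
  assumes "u \<in> verts G" "v \<in> verts G"
  shows "dist_digraph G u v \<le> diam G"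
proof -
  have "{dist_digraph G u v | u v. u \<in> verts G \<and> v \<in> verts G}
      = (\<lambda>(u, v). dist_digraph G u v) ` (verts G \<times> verts G)"
    by auto
  then show ?thesis
    unfolding diam_def using assms by (intro Max_ge) auto
qed

lemma dist_apath:
  assumes "strongly_connected G" "u \<in> verts G" "v \<in> verts G"
  obtains p where "apath u p v" "length p = dist_digraph G u v"
proof -
  have "u \<rightarrow>\<^sup>*\<^bsub>G\<^esub> v"
    using assms by (simp add: strongly_connected_def)
  then have "\<exists>k p. apath u p v \<and> length p = k"
    by (auto simp: reachable_apath)
  from LeastI_ex[OF this] that show ?thesis
    unfolding dist_digraph_def by blast
qed

lemma diam_eq_0:
  assumes "strongly_connected G" "\<And>i. i \<in> verts G \<Longrightarrow> in_nbrs G i = {}"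
  shows "diam G = 0"
proof -
  have "dist_digraph G u v = 0" if uv: "u \<in> verts G" "v \<in> verts G" for u v
  proof -
    obtain p where p: "apath u p v" "length p = dist_digraph G u v"
      using dist_apath[OF assms(1) uv] .
    have "p = []"
    proof (cases p)
      case (Cons e es)
      then have "e \<in> arcs G"
        using p(1) by (auto dest!: awalkI_apath simp: awalk_Cons_iff)
      then have "tail G e \<in> in_nbrs G (head G e)"
        by (auto simp: in_nbrs_def in_arcs_imp_in_arcs_ends)
      then show ?thesis
        using assms(2) \<open>e \<in> arcs G\<close> by auto
    qed
    then show ?thesis
      using p(2) by simp
  qed
  moreover have "verts G \<noteq> {}"
    using assms(1) by (simp add: strongly_connected_def)
  ultimately have "{dist_digraph G u v | u v. u \<in> verts G \<and> v \<in> verts G} = {0}"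
    by (auto; blast)
  then show ?thesis
    by (simp add: diam_def)
qed

lemma card_in_nbrs_le: "i \<in> verts G \<Longrightarrow> card (in_nbrs G i) \<le> max_in_nbrs G"
  unfolding max_in_nbrs_def by (intro Max_ge) auto

end

section \<open>Convergence\<close>

lemma (in qvcc_execution) converged:
  assumes "strongly_connected G"
    and "\<And>i. i \<in> verts G \<Longrightarrow> card (Cl i) \<le> m * q"
    and "i \<in> verts G" "phase_end q (max_in_nbrs G) (diam G) \<le> t"
  shows "V t i = vert \<delta> C"
proof (rule V_eq_vertI[OF assms(3)], rule subsetI)
  fix c assume c: "c \<in> vert \<delta> C"
  then obtain u where u: "u \<in> verts G" "c \<in> Cl u"
    using cover vert_subset[of \<delta> C] by blast
  then have "c \<in> V 0 u"
    using V_0 vert_restrict[OF c] Cl_subset by simp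
  moreover obtain p where p: "apath u p i" "length p = dist_digraph G u i"
    using dist_apath[OF assms(1) u(1) assms(3)] .
  ultimately have "c \<in> V (phase_end q (max_in_nbrs G) (length p)) i"
    using vertex_along_walk[OF awalkI_apath[OF p(1)] c card_in_nbrs_le assms(2), where k = 0]
    by simp
  moreover have "phase_end q (max_in_nbrs G) (length p) \<le> t"
    using phase_end_mono[OF dist_le_diam[OF u(1) assms(3)]] p(2) assms(4) le_trans by metis
  ultimately show "c \<in> V t i"
    using keep_vertex[OF assms(3) c] by blast
qed

theorem proposition5:
  fixes X :: "(real^'d) set" and a :: "real^'d"
    and \<Delta> :: "(real^'l) set" and f :: "real^'d \<Rightarrow> real^'l \<Rightarrow> real"
    and \<delta> :: "nat \<Rightarrow> real^'l" and N n m :: nat and C :: "nat set"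
    and G :: "nat pair_pre_digraph" and Cl :: "nat \<Rightarrow> nat set"
    and V :: "nat \<Rightarrow> nat \<Rightarrow> nat set" and Tr :: "nat \<Rightarrow> nat \<Rightarrow> nat list"
    and Nmax dmax :: nat
  assumes "compact X" and "convex X" and "convex \<Delta>"
    and "\<And>d. d \<in> \<Delta> \<Longrightarrow> convex_on UNIV (\<lambda>x. f x d)"
    and "\<And>x. x \<in> X \<Longrightarrow> convex_on \<Delta> (\<lambda>d. f x d)"
    and "C = {1..N}" and "\<And>j. j \<in> C \<Longrightarrow> \<delta> j \<in> \<Delta>"
    and unique_minimum: "\<And>S. S \<subseteq> C \<Longrightarrow> feasible_set X f \<delta> S \<noteq> {} \<Longrightarrow>
          \<exists>!x. is_solution a X f \<delta> S x"
    and "pair_fin_digraph G" and "pverts G = {1..n}" and "strongly_connected G"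
    and "\<And>i. i \<in> {1..n} \<Longrightarrow> Cl i \<subseteq> C" and "(\<Union>i\<in>{1..n}. Cl i) = C"
    and "m \<ge> 1"
    and run: "qvcc_run G \<delta> m Cl V Tr"
    and "Nmax = Max ((\<lambda>i. card (Cl i)) ` {1..n})"
    and "dmax = max_in_nbrs G"
  shows "(\<forall>i\<in>{1..n}. mono (\<lambda>t. Jstar a X f \<delta> (V t i))) \<and>
    (\<exists>T::nat.
       real T \<le> of_int \<lceil>real Nmax / real m\<rceil> * (((real dmax + 1) ^ diam G - 1) / real dmax) \<and>
       (\<forall>i\<in>{1..n}. \<forall>t\<ge>T. xstar a X f \<delta> (V t i) = xstar a X f \<delta> C) \<and>
       (\<forall>i\<in>{1..n}. V T i = vert \<delta> C \<and> vert \<delta> C \<supseteq> Sc a X f \<delta> C))"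
proof -
  have "fin_digraph (with_proj G)"
  proof -
    interpret pair_fin_digraph G by fact
    show ?thesis by unfold_locales
  qed
  have verts: "verts (with_proj G) = {1..n}"
    using assms by simp
  interpret qvcc_execution "with_proj G" \<delta> m Cl C V Tr
  proof (intro qvcc_execution.intro qvcc_execution_axioms.intro)
    show "finite C" "(\<Union>i\<in>verts (with_proj G). Cl i) = C"
      using assms verts by simp_all
  qed fact+
  have conv: "\<And>x. x \<in> X \<Longrightarrow> convex_on \<Delta> (f x)" and sub: "\<delta> ` C \<subseteq> \<Delta>"
    using assms by auto
  define q where "q = nat \<lceil>real Nmax / real m\<rceil>"
  define T where "T = phase_end q dmax (diam G)"

  have load: "card (Cl i) \<le> m * q" if "i \<in> verts (with_proj G)" for i
  proof -
    have "real Nmax / real m \<le> real q"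
      by (simp add: q_def real_nat_ceiling_ge)
    then have "real Nmax \<le> real (m * q)"
      using \<open>m \<ge> 1\<close> by (simp add: field_simps)
    moreover have "card (Cl i) \<le> Nmax"
      using that assms verts by (auto intro: Max_ge)
    ultimately show ?thesis
      by linarith
  qed
  have V_eq: "V t i = vert \<delta> C" if "i \<in> {1..n}" "T \<le> t" for i t
    using converged[OF \<open>strongly_connected G\<close> load] that verts assms by (simp add: T_def)

  have "mono (\<lambda>t. Jstar a X f \<delta> (V t i))" if "i \<in> {1..n}" for i
  proof (rule incseq_SucI, rule Jstar_mono)
    fix t
    have "i \<in> verts (with_proj G)"
      using that verts by simp
    then show "feasible_set X f \<delta> (V (Suc t) i) \<subseteq> feasible_set X f \<delta> (V t i)"
      using V_subset[of i "Suc t"] sub V_hull_mono[of i t]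
      by (intro feasible_set_antimono[where \<Delta> = \<Delta>] conv) auto
  qed
  moreover have "real T \<le> of_int \<lceil>real Nmax / real m\<rceil> * (((real dmax + 1) ^ diam G - 1) / real dmax)"
  proof (cases "dmax = 0")
    case True
    \<comment> \<open>Then there are no edges, so the diameter is \<open>0\<close>, and the right-hand side is \<open>0\<close> because \<open>x / 0 = 0\<close>.\<close>
    have "in_nbrs G i = {}" if "i \<in> verts (with_proj G)" for i
      using card_in_nbrs_le[OF that] finite_in_nbrs[of i] True assms by simp
    then have "diam G = 0"
      using diam_eq_0[OF \<open>strongly_connected G\<close>] by simp
    then show ?thesis
      using True by (simp add: T_def)
  next
    case False
    have "of_int \<lceil>real Nmax / real m\<rceil> = real q"
      by (simp add: q_def)
    then show ?thesis
      using False by (simp add: T_def real_phase_end)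
  qed
  moreover have "xstar a X f \<delta> (V t i) = xstar a X f \<delta> C" if "i \<in> {1..n}" "T \<le> t" for i t
    using V_eq[OF that] feasible_set_vert[where X = X and f = f, OF conv sub finite_C]
    by (simp add: xstar_def is_solution_def[abs_def])
  moreover have "V T i = vert \<delta> C" if "i \<in> {1..n}" for i
    using V_eq that by simp
  moreover have "Sc a X f \<delta> C \<subseteq> vert \<delta> C"
    using Sc_subset_vert[OF conv sub finite_C] .
  ultimately show ?thesis
    by blast
qed

end
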